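(* Let $\mathcal{X},\mathcal{Y}$ be finite sets, $\mathcal{W}_{Y|X,Y'}$ a Markov channel kernel such that for every input distribution on $\mathcal{X}$ the induced Markov chain on $\mathcal{Y}$ has a unique recurrent class, which is irreducible and aperiodic, and let $\mathcal{P}_X$ be a distribution on $\mathcal{X}$ with associated equilibrium distribution $\pi$. Put $\mathcal{Q}_{Y'XY}=\pi_{Y'}\mathcal{P}_X\mathcal{W}_{Y|X,Y'}$. For any $\delta>0$ there exist $\varepsilon_0>0$ and $N_0\in\mathbb{N}$ such that for all $\varepsilon<\varepsilon_0$, all $n>N_0$ and all $(x^n,y^n)\in\mathcal{T}_\varepsilon^{(n)}(\mathcal{Q}_{Y'XY})$, if a random sequence $(X^n,Y^n)$ is generated, with an arbitrary starting state $Y_0$, according to $(X^n,Y^n)\sim\mathcal{P}_X^{\otimes n}\cdot\prod_{t=1}^n\mathcal{W}_{Y|X,Y'}(Y_t|X_t,Y_{t-1})$, then: 1) (AEP) $\;2^{-n(H(X,Y|Y')+\delta)}<\mathbb{P}\big((X^n,Y^n)=(x^n,y^n)\big)<2^{-n(H(X,Y|Y')-\delta)}$; 2) (Cardinality bound) $\;|\mathcal{T}_\varepsilon^{(n)}(\mathcal{Q}_{Y'XY})|<2^{n(H(X,Y|Y')+\delta)}$.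
   Context: $\mathcal{W}_{Y|X,Y'}(y|x,y')$ is the probability of new state $y$ given input $x$ and previous state $y'$. For an input distribution $\mathcal{P}_X$, the induced Markov chain on $\mathcal{Y}$ has transition matrix $T(y|y')=\sum_x\mathcal{P}_X(x)\mathcal{W}_{Y|X,Y'}(y|x,y')$, and $\pi$ is its unique equilibrium distribution: $\pi(y)=\sum_{x,y'}\pi(y')\mathcal{P}_X(x)\mathcal{W}_{Y|X,Y'}(y|x,y')$. Thus $\mathcal{Q}_{Y'XY}(i,x,j)=\pi(i)\mathcal{P}_X(x)\mathcal{W}_{Y|X,Y'}(j|x,i)$. Entropies (base 2) are computed for $(Y',X,Y)\sim\mathcal{Q}_{Y'XY}$; $H(X,Y|Y')=H(X)+H(Y|X,Y')$ is the conditional entropy. For sequences $(x^n,y^n)\in\mathcal{X}^n\times\mathcal{Y}^n$ with starting state $y_0$ (the same starting state as the random sequence), define $$Q^n_{Y'XY}(i,x,j)=\frac1n\sum_{t=1}^n\mathbf{1}\{(y_{t-1},x_t,y_t)=(i,x,j)\},\quad x\in\mathcal{X},\ (i,j)\in\mathcal{Y}^2.$$ The set of input-driven Markov typical sequences is $\mathcal{T}_\varepsilon^{(n)}(\mathcal{Q}_{Y'XY})=\{(x^n,y^n):\lVert Q^n_{Y'XY}-\mathcal{Q}_{Y'XY}\rVert_1\leq\varepsilon\}$, where $\lVert\cdot\rVert_1$ is the $\ell_1$ norm (sum of absolute values), $\varepsilon>0$.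
   Formalization: The lower bound in 1) is claimed only for typical sequences with positive probability P((X^n,Y^n)=(x^n,y^n))>0, since the typical set may contain sequences of probability zero, for which the printed strict lower bound is false. *)

theory Defs
  imports "HOL-Probability.Probability"
begin

section \<open>Finite Markov chains\<close>

text \<open>A time-homogeneous chain on a finite state space is given by its kernel
  \<open>K :: 'y \<Rightarrow> 'y pmf\<close>, where \<open>pmf (K i) j\<close> is the transition probability from \<open>i\<close> to \<open>j\<close>.\<close>

definition n_step :: "('y::finite \<Rightarrow> 'y pmf) \<Rightarrow> nat \<Rightarrow> 'y \<Rightarrow> 'y pmf" where
  "n_step K n i = ((\<lambda>p. bind_pmf p K) ^^ n) (return_pmf i)"

text \<open>\<open>first_passage K n i j\<close> is the probability that the chain started in \<open>i\<close> visits \<open>j\<close> at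
  time \<open>n + 1\<close> and at none of the times \<open>1, \<dots>, n\<close>.\<close>

primrec first_passage :: "('y::finite \<Rightarrow> 'y pmf) \<Rightarrow> nat \<Rightarrow> 'y \<Rightarrow> 'y \<Rightarrow> real" where
  "first_passage K 0 i j = pmf (K i) j"
| "first_passage K (Suc n) i j = (\<Sum>k\<in>UNIV - {j}. pmf (K i) k * first_passage K n k j)"

definition recurrent_state :: "('y::finite \<Rightarrow> 'y pmf) \<Rightarrow> 'y \<Rightarrow> bool" where
  "recurrent_state K i \<longleftrightarrow> (\<lambda>n. first_passage K n i i) sums 1"

definition accessible :: "('y::finite \<Rightarrow> 'y pmf) \<Rightarrow> 'y \<Rightarrow> 'y \<Rightarrow> bool" where
  "accessible K i j \<longleftrightarrow> (\<exists>n. pmf (n_step K n i) j > 0)"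

definition communicating_class :: "('y::finite \<Rightarrow> 'y pmf) \<Rightarrow> 'y \<Rightarrow> 'y set" where
  "communicating_class K i = {j. accessible K i j \<and> accessible K j i}"

definition recurrent_class :: "('y::finite \<Rightarrow> 'y pmf) \<Rightarrow> 'y set \<Rightarrow> bool" where
  "recurrent_class K C \<longleftrightarrow> (\<exists>i. recurrent_state K i \<and> C = communicating_class K i)"

definition irreducible_on :: "('y::finite \<Rightarrow> 'y pmf) \<Rightarrow> 'y set \<Rightarrow> bool" where
  "irreducible_on K C \<longleftrightarrow> (\<forall>i\<in>C. \<forall>j\<in>C. accessible K i j)"

definition period :: "('y::finite \<Rightarrow> 'y pmf) \<Rightarrow> 'y \<Rightarrow> nat" where
  "period K i = Gcd {n. n > 0 \<and> pmf (n_step K n i) i > 0}"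

definition aperiodic_on :: "('y::finite \<Rightarrow> 'y pmf) \<Rightarrow> 'y set \<Rightarrow> bool" where
  "aperiodic_on K C \<longleftrightarrow> (\<forall>i\<in>C. period K i = 1)"

definition unichain_aperiodic :: "('y::finite \<Rightarrow> 'y pmf) \<Rightarrow> bool" where
  "unichain_aperiodic K \<longleftrightarrow>
     (\<exists>!C. recurrent_class K C) \<and>
     (\<forall>C. recurrent_class K C \<longrightarrow> irreducible_on K C \<and> aperiodic_on K C)"


section \<open>Input-driven Markov channels\<close>

text \<open>A Markov channel is a kernel \<open>W :: 'x \<Rightarrow> 'y \<Rightarrow> 'y pmf\<close>; \<open>pmf (W x i) j\<close> is the probability of
  the new state \<open>j\<close> given the input \<open>x\<close> and the previous state \<open>i\<close>.\<close>

definition induced_chain :: "'x::finite pmf \<Rightarrow> ('x \<Rightarrow> 'y::finite \<Rightarrow> 'y pmf) \<Rightarrow> 'y \<Rightarrow> 'y pmf" where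
  "induced_chain P W i = bind_pmf P (\<lambda>x. W x i)"

lemma pmf_induced_chain: "pmf (induced_chain P W i) j = (\<Sum>x\<in>UNIV. pmf P x * pmf (W x i) j)"
  by (simp add: induced_chain_def pmf_bind integral_measure_pmf[of UNIV] ac_simps)

definition equilibrium :: "'x::finite pmf \<Rightarrow> ('x \<Rightarrow> 'y::finite \<Rightarrow> 'y pmf) \<Rightarrow> 'y pmf \<Rightarrow> bool" where
  "equilibrium P W \<pi> \<longleftrightarrow>
     (\<forall>j. pmf \<pi> j = (\<Sum>x\<in>UNIV. \<Sum>i\<in>UNIV. pmf \<pi> i * pmf P x * pmf (W x i) j))"

text \<open>The joint law of (previous state, input, new state).\<close>

definition joint_law ::
    "'y::finite pmf \<Rightarrow> 'x::finite pmf \<Rightarrow> ('x \<Rightarrow> 'y \<Rightarrow> 'y pmf) \<Rightarrow> ('y \<times> 'x \<times> 'y) pmf" where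
  "joint_law \<pi> P W = bind_pmf \<pi> (\<lambda>i. bind_pmf P (\<lambda>x. map_pmf (\<lambda>j. (i, x, j)) (W x i)))"

lemma pmf_map_Pair2:
  "pmf (map_pmf (\<lambda>j. (a, b, j)) p) (i, x, k) = (if a = i \<and> b = x then pmf p k else 0)"
proof (cases "a = i \<and> b = x")
  case True
  have "inj (\<lambda>j. (a, b, j))" by (auto intro: injI)
  from pmf_map_inj'[OF this, of p k] True show ?thesis by simp
next
  case False
  then show ?thesis by (auto intro!: pmf_map_outside)
qed

lemma pmf_joint_law: "pmf (joint_law \<pi> P W) (i, x, j) = pmf \<pi> i * pmf P x * pmf (W x i) j"
  unfolding joint_law_def pmf_bind pmf_map_Pair2
proof -
  have *: "(\<integral>b. (if a = i \<and> b = x then pmf (W b a) j else 0) \<partial>P)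
      = (if a = i then pmf P x * pmf (W x i) j else 0)" for a
    by (subst integral_measure_pmf[of "{x}"]) (auto split: if_splits)
  show "(\<integral>a. \<integral>b. (if a = i \<and> b = x then pmf (W b a) j else 0) \<partial>P \<partial>\<pi>)
      = pmf \<pi> i * pmf P x * pmf (W x i) j"
    unfolding * by (subst integral_measure_pmf[of "{i}"]) (auto split: if_splits)
qed

text \<open>\<open>H(X, Y | Y')\<close> in bits, for \<open>(Y', X, Y)\<close> distributed according to \<open>Q\<close>.\<close>

definition cond_entropy_joint :: "('y::finite \<times> 'x::finite \<times> 'y) pmf \<Rightarrow> real" where
  "cond_entropy_joint Q =
     prob_space.conditional_entropy (measure_pmf Q) 2 (count_space UNIV) (count_space UNIV)
       (\<lambda>(i, x, j). (x, j)) (\<lambda>(i, x, j). i)"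

lemma cond_entropy_joint_eq:
  "cond_entropy_joint (joint_law \<pi> P W) =
     - (\<Sum>i\<in>UNIV. \<Sum>x\<in>UNIV. \<Sum>j\<in>UNIV.
          pmf \<pi> i * pmf P x * pmf (W x i) j * log 2 (pmf P x * pmf (W x i) j))"
proof -
  let ?Q = "joint_law \<pi> P W"
  let ?X = "\<lambda>(i, x, j). (x, j)" and ?Y = "\<lambda>(i, x, j). i"
  interpret information_space "measure_pmf ?Q" 2
    by unfold_locales simp
  have rX: "range ?X = UNIV" and rY: "range ?Y = UNIV"
    by (auto simp: image_def)
  have "pmf (map_pmf ?Y ?Q) i = pmf \<pi> i" for i
    by (simp add: joint_law_def map_bind_pmf pmf.map_comp o_def map_pmf_const bind_return_pmf')
  then have mY: "measure ?Q (?Y -` {i}) = pmf \<pi> i" for i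
    by (simp add: pmf_map)
  have Y: "simple_distributed ?Q ?Y (\<lambda>i. pmf \<pi> i)"
    by (rule measure_pmf.simple_distributedI) (auto simp: simple_function_def mY)
  have XY: "simple_distributed ?Q (\<lambda>z. (?X z, ?Y z)) (\<lambda>((x, j), i). pmf ?Q (i, x, j))"
  proof (rule measure_pmf.simple_distributedI)
    fix v assume "v \<in> (\<lambda>z. (?X z, ?Y z)) ` space ?Q"
    obtain x j i where v: "v = ((x, j), i)" by (metis prod.exhaust)
    have "(\<lambda>z. (?X z, ?Y z)) -` {v} = {(i, x, j)}" unfolding v by auto
    then show "(\<lambda>((x, j), i). pmf ?Q (i, x, j)) v = measure ?Q ((\<lambda>z. (?X z, ?Y z)) -` {v} \<inter> space ?Q)"
      by (simp add: v measure_pmf_single)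
  qed (auto simp: simple_function_def split: prod.splits)
  have rXY: "range (\<lambda>z. (?X z, ?Y z)) = UNIV"
    by (auto simp: image_def)
  have "cond_entropy_joint ?Q = - (\<Sum>((x, j), i)\<in>UNIV. pmf ?Q (i, x, j) * log 2 (pmf ?Q (i, x, j) / pmf \<pi> i))"
    unfolding cond_entropy_joint_def
    using conditional_entropy_eq[OF Y XY, unfolded space_measure_pmf rX rY rXY]
    by (simp add: case_prod_unfold)
  also have "(\<Sum>((x, j), i)\<in>UNIV. pmf ?Q (i, x, j) * log 2 (pmf ?Q (i, x, j) / pmf \<pi> i))
    = (\<Sum>(i, x, j)\<in>UNIV. pmf ?Q (i, x, j) * log 2 (pmf ?Q (i, x, j) / pmf \<pi> i))"
    by (rule sum.reindex_bij_witness[of _ "\<lambda>(i,x,j). ((x,j),i)" "\<lambda>((x,j),i). (i,x,j)"]) auto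
  also have "\<dots> = (\<Sum>(i, x, j)\<in>UNIV. pmf \<pi> i * pmf P x * pmf (W x i) j * log 2 (pmf P x * pmf (W x i) j))"
    by (rule sum.cong) (auto simp: pmf_joint_law)
  also have "\<dots> = (\<Sum>i\<in>UNIV. \<Sum>x\<in>UNIV. \<Sum>j\<in>UNIV.
          pmf \<pi> i * pmf P x * pmf (W x i) j * log 2 (pmf P x * pmf (W x i) j))"
    by (simp add: sum.cartesian_product flip: UNIV_Times_UNIV)
  finally show ?thesis .
qed


section \<open>Random sequences and typical sequences\<close>

text \<open>Sequences are lists, so \<open>x\<^sub>t = xs ! (t - 1)\<close>, and \<open>y\<^sub>t = (y\<^sub>0 # ys) ! t\<close> for \<open>0 \<le> t \<le> n\<close>.\<close>

primrec sequence_law ::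
    "'x::finite pmf \<Rightarrow> ('x \<Rightarrow> 'y::finite \<Rightarrow> 'y pmf) \<Rightarrow> nat \<Rightarrow> 'y \<Rightarrow> ('x list \<times> 'y list) pmf" where
  "sequence_law P W 0 y0 = return_pmf ([], [])"
| "sequence_law P W (Suc n) y0 =
     bind_pmf P (\<lambda>x. bind_pmf (W x y0) (\<lambda>y.
       map_pmf (\<lambda>(xs, ys). (x # xs, y # ys)) (sequence_law P W n y)))"

lemma pmf_map_Cons2:
  "pmf (map_pmf (\<lambda>(xs, ys). (a # xs, b # ys)) p) (x # us, y # vs)
     = (if a = x \<and> b = y then pmf p (us, vs) else 0)"
proof (cases "a = x \<and> b = y")
  case True
  have "inj (\<lambda>(xs, ys). (a # xs, b # ys))" by (auto intro: injI)
  from pmf_map_inj'[OF this, of p "(us, vs)"] True show ?thesis by simp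
next
  case False
  then show ?thesis by (auto intro!: pmf_map_outside)
qed

lemma pmf_sequence_law_Cons:
  "pmf (sequence_law P W (Suc n) y0) (x # xs, y # ys)
     = pmf P x * pmf (W x y0) y * pmf (sequence_law P W n y) (xs, ys)"
proof -
  have *: "(\<integral>b. (if a = x \<and> b = y then pmf (sequence_law P W n b) (xs, ys) else 0) \<partial>W a y0)
      = (if a = x then pmf (W x y0) y * pmf (sequence_law P W n y) (xs, ys) else 0)" for a
    by (subst integral_measure_pmf[of "{y}"]) (auto split: if_splits)
  show ?thesis
    unfolding sequence_law.simps pmf_bind pmf_map_Cons2 *
    by (subst integral_measure_pmf[of "{x}"]) (auto split: if_splits)
qed

lemma pmf_sequence_law:
  assumes "length xs = n" and "length ys = n"
  shows "pmf (sequence_law P W n y0) (xs, ys) =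
           (\<Prod>t=1..n. pmf P (xs ! (t - 1))) *
           (\<Prod>t=1..n. pmf (W (xs ! (t - 1)) ((y0 # ys) ! (t - 1))) ((y0 # ys) ! t))"
  using assms
proof (induction n arbitrary: xs ys y0)
  case 0
  then show ?case by simp
next
  case (Suc n)
  then obtain x us y vs where eq: "xs = x # us" "ys = y # vs"
    and len: "length us = n" "length vs = n"
    by (auto simp: length_Suc_conv)
  have shift: "(\<Prod>t=1..Suc n. f t) = f 1 * (\<Prod>t=1..n. f (Suc t))" for f :: "nat \<Rightarrow> real"
    by (simp add: prod.atLeast_Suc_atMost prod.shift_bounds_cl_Suc_ivl del: prod.cl_ivl_Suc)
  have nth: "(z # zs) ! t = zs ! (t - 1)" if "t \<in> {1..n}" for z t and zs :: "'c list"
    using that by (cases t) auto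
  have "(\<Prod>t=1..n. pmf P ((x # us) ! t)) = (\<Prod>t=1..n. pmf P (us ! (t - 1)))"
    by (intro prod.cong refl) (simp only: nth)
  moreover have "(\<Prod>t=1..n. pmf (W ((x # us) ! t) ((y0 # y # vs) ! t)) ((y # vs) ! t)) =
      (\<Prod>t=1..n. pmf (W (us ! (t - 1)) ((y # vs) ! (t - 1))) ((y # vs) ! t))"
    by (intro prod.cong refl) (simp only: nth)
  ultimately show ?case
    unfolding eq pmf_sequence_law_Cons shift Suc.IH[OF len] by simp
qed

definition empirical ::
    "nat \<Rightarrow> 'y::finite \<Rightarrow> 'x::finite list \<Rightarrow> 'y list \<Rightarrow> 'y \<times> 'x \<times> 'y \<Rightarrow> real" where
  "empirical n y0 xs ys a =
     (\<Sum>t=1..n. of_bool (((y0 # ys) ! (t - 1), xs ! (t - 1), (y0 # ys) ! t) = a)) / real n"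

definition typical ::
    "('y::finite \<times> 'x::finite \<times> 'y) pmf \<Rightarrow> 'y \<Rightarrow> real \<Rightarrow> nat \<Rightarrow> ('x list \<times> 'y list) set" where
  "typical Q y0 \<epsilon> n =
     {(xs, ys). length xs = n \<and> length ys = n \<and>
        (\<Sum>a\<in>UNIV. \<bar>empirical n y0 xs ys a - pmf Q a\<bar>) \<le> \<epsilon>}"

text \<open>The typical set constrains frequencies only up to \<open>\<epsilon>\<close>, so it may contain sequences of
  probability zero: a single use of an input or transition of probability zero is not excluded
  once \<open>2 / n \<le> \<epsilon>\<close>. A strictly positive lower bound on the probability of a typical sequence
  therefore needs that probability to be nonzero.\<close>

lemma typical_probability_zero:
  fixes P :: "bool pmf" and W :: "bool \<Rightarrow> unit \<Rightarrow> unit pmf"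
  defines "P \<equiv> return_pmf False" and "W \<equiv> \<lambda>_ _. return_pmf ()"
  assumes n: "n > 0" "2 / real n \<le> \<epsilon>"
  shows "unichain_aperiodic (induced_chain P' W)" "equilibrium P W (return_pmf ())"
   and "(True # replicate (n - 1) False, replicate n ()) \<in> typical (joint_law (return_pmf ()) P W) () \<epsilon> n"
   and "pmf (sequence_law P W n ()) (True # replicate (n - 1) False, replicate n ()) = 0"
proof -
  have K: "induced_chain P' W = (\<lambda>_. return_pmf ())" unfolding induced_chain_def W_def by auto
  have ns: "n_step (\<lambda>_::unit. return_pmf ()) m i = return_pmf ()" for m i
    unfolding n_step_def by (induction m) (auto simp: bind_return_pmf)
  have fp: "first_passage (\<lambda>_::unit. return_pmf ()) m i j = (if m = 0 then 1 else 0)" for m i j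
    by (cases m) (auto simp: UNIV_unit)
  have "recurrent_state (induced_chain P' W) i" for i unfolding K recurrent_state_def fp
    using sums_single[of 0 "\<lambda>_. 1::real"] by simp
  moreover have "communicating_class (induced_chain P' W) i = UNIV" for i
    unfolding K communicating_class_def accessible_def ns by auto
  ultimately have rc: "recurrent_class (induced_chain P' W) C \<longleftrightarrow> C = UNIV" for C
    unfolding recurrent_class_def by auto
  have "Gcd {m::nat. m > 0} = 1"
    by (metis Gcd_dvd_nat mem_Collect_eq nat_dvd_1_iff_1 zero_less_one)
  then show "unichain_aperiodic (induced_chain P' W)"
    unfolding unichain_aperiodic_def rc
    unfolding irreducible_on_def aperiodic_on_def period_def accessible_def K ns by simp
  show "equilibrium P W (return_pmf ())"
    unfolding equilibrium_def P_def W_def by (simp add: UNIV_unit UNIV_bool)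
  obtain m where m: "n = Suc m" using n by (cases n) auto
  show "pmf (sequence_law P W n ()) (True # replicate (n - 1) False, replicate n ()) = 0"
    unfolding m by (simp only: replicate_Suc pmf_sequence_law_Cons) (simp add: P_def)
  let ?e = "empirical n () (True # replicate (n - 1) False) (replicate n ())"
  have "?e ((),True,()) = (\<Sum>t=1..n. of_bool (t = 1)) / real n"
    unfolding empirical_def by (intro arg_cong2[where f="(/)"] sum.cong refl) (auto simp: nth_Cons split: nat.splits)
  also have "(\<Sum>t=1..n. of_bool (t = 1)) = (1::real)" using n by (simp add: sum.delta of_bool_def)
  finally have e1: "?e ((),True,()) = 1 / n" by simp
  have "?e ((),False,()) = (\<Sum>t=1..n. 1 - of_bool (t = 1)) / real n"
    unfolding empirical_def by (intro arg_cong2[where f="(/)"] sum.cong refl) (auto simp: nth_Cons split: nat.splits)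
  also have "(\<Sum>t=1..n. 1 - of_bool (t = 1)) = (real n - 1)" using n by (simp add: sum_subtractf of_bool_def)
  finally have e0: "?e ((),False,()) = 1 - 1 / n" using n by (simp add: field_simps)
  have U: "(UNIV :: (unit \<times> bool \<times> unit) set) = {((),False,()), ((),True,())}" by auto
  show "(True # replicate (n - 1) False, replicate n ()) \<in> typical (joint_law (return_pmf ()) P W) () \<epsilon> n"
    unfolding typical_def U using n by (simp add: e0[simplified] e1[simplified] pmf_joint_law P_def W_def)
qed
end

theory Submission
  imports Defs
begin

text \<open>The base-2 logarithm of the probability of a sequence is an affine function of its
  empirical law, so on the typical set it differs from its value at \<open>Q\<close> by at most \<open>n \<epsilon>\<close> times a
  constant; no ergodicity is needed. For the cardinality bound this applies only to sequences of
  positive probability, so \<open>P\<close> and \<open>W\<close> are first mixed with a little uniform noise. Then every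
  sequence has positive probability, and the exponent at \<open>Q\<close> drops by at most an arbitrarily small
  amount, since the mixing lowers each factor by at most a fixed ratio.\<close>

definition step_prob :: "'x::finite pmf \<Rightarrow> ('x \<Rightarrow> 'y::finite \<Rightarrow> 'y pmf) \<Rightarrow> 'y \<times> 'x \<times> 'y \<Rightarrow> real" where
  "step_prob P W = (\<lambda>(i, x, j). pmf P x * pmf (W x i) j)"

text \<open>\<open>step_prob\<close> is the conditional law of input and new state given the
  previous state, so the entropy is its mean negative logarithm. A single sum over triples can be
  compared directly with a sum against \<open>empirical\<close>.\<close>

lemma cond_entropy_joint_step_prob:
  "cond_entropy_joint (joint_law \<pi> P W) =
     - (\<Sum>a\<in>UNIV. pmf (joint_law \<pi> P W) a * log 2 (step_prob P W a))"
proof -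
  have "(\<Sum>a\<in>UNIV. pmf (joint_law \<pi> P W) a * log 2 (step_prob P W a)) =
      (\<Sum>(i, x, j)\<in>UNIV. pmf \<pi> i * pmf P x * pmf (W x i) j * log 2 (pmf P x * pmf (W x i) j))"
    by (rule sum.cong) (auto simp: pmf_joint_law step_prob_def)
  also have "\<dots> = (\<Sum>i\<in>UNIV. \<Sum>x\<in>UNIV. \<Sum>j\<in>UNIV.
          pmf \<pi> i * pmf P x * pmf (W x i) j * log 2 (pmf P x * pmf (W x i) j))"
    by (simp add: sum.cartesian_product flip: UNIV_Times_UNIV)
  finally show ?thesis
    by (simp add: cond_entropy_joint_eq)
qed

lemma pmf_sequence_law_step_prob:
  assumes "length xs = n" "length ys = n"
  shows "pmf (sequence_law P W n y0) (xs, ys) =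
    (\<Prod>t=1..n. step_prob P W ((y0 # ys) ! (t - 1), xs ! (t - 1), (y0 # ys) ! t))"
  by (simp only: pmf_sequence_law[OF assms] step_prob_def prod.distrib prod.case)

text \<open>Grouping the times by the triple seen there makes a sum along the path linear in the
  empirical law. Positivity of \<open>n\<close> undoes the division in
  \<open>empirical\<close>.\<close>

lemma sum_empirical:
  assumes "n > 0"
  shows "(\<Sum>t=1..n. f ((y0 # ys) ! (t - 1), xs ! (t - 1), (y0 # ys) ! t)) =
    real n * (\<Sum>a\<in>UNIV. empirical n y0 xs ys a * f a)"
proof -
  define s where "s t = ((y0 # ys) ! (t - 1), xs ! (t - 1), (y0 # ys) ! t)" for t
  have "real n * (\<Sum>a\<in>UNIV. empirical n y0 xs ys a * f a) =
      (\<Sum>a\<in>UNIV. \<Sum>t=1..n. of_bool (s t = a) * f a)"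
    using assms by (simp add: empirical_def s_def sum_distrib_left sum_distrib_right)
  also have "\<dots> = (\<Sum>t=1..n. \<Sum>a\<in>UNIV. of_bool (s t = a) * f a)"
    by (rule sum.swap)
  also have "\<dots> = (\<Sum>t=1..n. f (s t))"
    by (intro sum.cong refl) (simp add: of_bool_def if_distrib[of "\<lambda>c. c * _"] cong: if_cong)
  finally show ?thesis
    by (simp add: s_def)
qed

text \<open>The log-probability is \<open>n\<close> times the empirical mean of
  \<open>log 2 (step_prob P W a)\<close>; replacing the empirical law by \<open>Q\<close> costs at
  most their l1 distance times a bound on the logarithms. At triples of step probability 0 the
  logarithm is merely some fixed real, so the bound stays finite, and \<open>pos\<close> keeps such
  triples off the path.\<close>

lemma log_pmf_sequence_law_typical:
  fixes P :: "'x::finite pmf" and W :: "'x \<Rightarrow> 'y::finite \<Rightarrow> 'y pmf"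
  assumes typ_seq: "(xs, ys) \<in> typical Q y0 \<epsilon> n" and n: "n > 0"
    and pos: "pmf (sequence_law P W n y0) (xs, ys) > 0"
  shows "\<bar>log 2 (pmf (sequence_law P W n y0) (xs, ys)) - n * (\<Sum>a\<in>UNIV. pmf Q a * log 2 (step_prob P W a))\<bar>
     \<le> n * \<epsilon> * (\<Sum>a\<in>UNIV. \<bar>log 2 (step_prob P W a)\<bar>)"
proof -
  let ?e = "empirical n y0 xs ys" and ?f = "\<lambda>a. log 2 (step_prob P W a)"
  let ?s = "\<lambda>t. ((y0 # ys) ! (t - 1), xs ! (t - 1), (y0 # ys) ! t)"
  have len: "length xs = n" "length ys = n" and dist: "(\<Sum>a\<in>UNIV. \<bar>?e a - pmf Q a\<bar>) \<le> \<epsilon>"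
    using typ_seq by (auto simp: typical_def)
  have prob: "pmf (sequence_law P W n y0) (xs, ys) = (\<Prod>t=1..n. step_prob P W (?s t))"
    by (rule pmf_sequence_law_step_prob[OF len])
  have nonneg: "step_prob P W a \<ge> 0" for a
    by (auto simp: step_prob_def split: prod.splits)
  \<comment> \<open>The logarithm of the product splits only if no factor vanishes; a nonzero
    product guarantees this.\<close>
  have step_pos: "step_prob P W (?s t) > 0" if "t \<in> {1..n}" for t
  proof -
    have "(\<Prod>t=1..n. step_prob P W (?s t)) \<noteq> 0"
      using pos unfolding prob by (rule less_imp_neq[THEN not_sym])
    then have "step_prob P W (?s t) \<noteq> 0"
      using that unfolding prod_zero_iff[OF finite_atLeastAtMost] by blast
    then show ?thesis
      using nonneg order_less_le by metis
  qed
  have "log 2 (pmf (sequence_law P W n y0) (xs, ys)) = (\<Sum>t=1..n. ?f (?s t))"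
    unfolding prob log_def sum_divide_distrib[symmetric]
    by (intro arg_cong2[where f = "(/)"] ln_prod refl step_pos less_imp_neq[THEN not_sym]) auto
  also have "\<dots> = n * (\<Sum>a\<in>UNIV. ?e a * ?f a)"
    by (rule sum_empirical[OF n])
  finally have diff: "log 2 (pmf (sequence_law P W n y0) (xs, ys)) - n * (\<Sum>a\<in>UNIV. pmf Q a * ?f a)
      = n * (\<Sum>a\<in>UNIV. (?e a - pmf Q a) * ?f a)"
    by (simp add: sum_subtractf left_diff_distrib right_diff_distrib)
  have "\<bar>\<Sum>a\<in>UNIV. (?e a - pmf Q a) * ?f a\<bar> \<le> (\<Sum>a\<in>UNIV. \<bar>?e a - pmf Q a\<bar> * \<bar>?f a\<bar>)"
    by (rule order_trans[OF sum_abs]) (simp add: abs_mult)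
  \<comment> \<open>Hoelder's inequality, with the sum of all \<open>\<bar>?f b\<bar>\<close> as a
    crude bound for their maximum.\<close>
  also have "\<dots> \<le> (\<Sum>a\<in>UNIV. \<bar>?e a - pmf Q a\<bar> * (\<Sum>b\<in>UNIV. \<bar>?f b\<bar>))"
    by (intro sum_mono mult_left_mono member_le_sum) auto
  also have "\<dots> \<le> \<epsilon> * (\<Sum>b\<in>UNIV. \<bar>?f b\<bar>)"
    unfolding sum_distrib_right[symmetric] by (intro mult_right_mono dist sum_nonneg) auto
  finally show ?thesis
    unfolding diff by (simp add: abs_mult mult.assoc mult_left_mono)
qed

definition mix_uniform :: "real \<Rightarrow> 'a::finite pmf \<Rightarrow> 'a pmf" where
  "mix_uniform \<eta> p = bind_pmf (bernoulli_pmf \<eta>) (\<lambda>b. if b then pmf_of_set UNIV else p)"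

lemma pmf_mix_uniform:
  assumes "0 \<le> \<eta>" "\<eta> \<le> 1"
  shows "pmf (mix_uniform \<eta> p) x = \<eta> / CARD('a) + (1 - \<eta>) * pmf (p :: 'a::finite pmf) x"
  using assms by (simp add: mix_uniform_def pmf_bind)

lemma pmf_mix_uniform_pos:
  assumes "0 < \<eta>" "\<eta> \<le> 1"
  shows "pmf (mix_uniform \<eta> p) x > 0"
  using assms by (simp add: pmf_mix_uniform add_pos_nonneg)

lemma pmf_mix_uniform_ge:
  assumes "0 \<le> \<eta>" "\<eta> \<le> 1"
  shows "pmf (mix_uniform \<eta> p) x \<ge> (1 - \<eta>) * pmf p x"
  using assms by (simp add: pmf_mix_uniform)

text \<open>Disjoint atoms of mass at least \<open>c\<close> have total mass at most 1. For infinite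
  \<open>A\<close> the convention \<open>card A = 0\<close> settles the claim.\<close>

lemma card_mult_le_one_pmf:
  assumes "\<And>a. a \<in> A \<Longrightarrow> c \<le> pmf p a"
  shows "real (card A) * c \<le> 1"
proof (cases "finite A")
  case True
  have "real (card A) * c = (\<Sum>a\<in>A. c)"
    by simp
  also have "\<dots> \<le> sum (pmf p) A"
    by (intro sum_mono assms)
  also have "\<dots> = measure p A"
    using True by (simp add: measure_measure_pmf_finite)
  finally show ?thesis
    using measure_pmf.prob_le_1[of p A] by linarith
qed simp

text \<open>Every typical sequence has probability at least the reciprocal of the bound, so no more
  of them fit into total mass 1. \<open>Q\<close> is kept separate from \<open>P\<close> and
  \<open>W\<close>: it will be the original law, while they will be the mixed ones.\<close>

lemma card_typical_le:
  fixes P :: "'x::finite pmf" and W :: "'x \<Rightarrow> 'y::finite \<Rightarrow> 'y pmf"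
  assumes pos: "\<And>a. step_prob P W a > 0" and n: "n > 0"
  shows "real (card (typical Q y0 \<epsilon> n)) \<le>
     2 powr (n * (\<epsilon> * (\<Sum>a\<in>UNIV. \<bar>log 2 (step_prob P W a)\<bar>)
                   - (\<Sum>a\<in>UNIV. pmf Q a * log 2 (step_prob P W a))))"
    (is "_ \<le> 2 powr ?E")
proof -
  have "2 powr (- ?E) \<le> pmf (sequence_law P W n y0) z" if "z \<in> typical Q y0 \<epsilon> n" for z
  proof -
    obtain xs ys where z: "z = (xs, ys)"
      by fastforce
    have len: "length xs = n" "length ys = n"
      using that by (auto simp: typical_def z)
    have pos': "pmf (sequence_law P W n y0) (xs, ys) > 0"
      unfolding pmf_sequence_law_step_prob[OF len] by (intro prod_pos ballI pos)
    have "- ?E \<le> log 2 (pmf (sequence_law P W n y0) (xs, ys))"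
      using log_pmf_sequence_law_typical[OF that[unfolded z] n pos']
      by (simp add: algebra_simps abs_le_iff)
    then show ?thesis
      using pos' by (simp add: z le_log_iff)
  qed
  then have "real (card (typical Q y0 \<epsilon> n)) * 2 powr (- ?E) \<le> 1"
    by (rule card_mult_le_one_pmf)
  then show ?thesis
    by (simp only: powr_minus flip: divide_inverse) (simp add: divide_le_eq)
qed

text \<open>A step probability is a product of two factors, each reduced by mixing to no less than
  \<open>1 - \<eta>\<close> times itself; hence the two logarithms lost.\<close>

lemma sum_log_step_prob_mix_uniform_ge:
  fixes P :: "'x::finite pmf" and W :: "'x \<Rightarrow> 'y::finite \<Rightarrow> 'y pmf"
  assumes \<eta>: "0 < \<eta>" "\<eta> < 1"
  shows "(\<Sum>a\<in>UNIV. pmf (joint_law \<pi> P W) a *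
            log 2 (step_prob (mix_uniform \<eta> P) (\<lambda>x i. mix_uniform \<eta> (W x i)) a))
     \<ge> - cond_entropy_joint (joint_law \<pi> P W) + 2 * log 2 (1 - \<eta>)"
proof -
  let ?Q = "joint_law \<pi> P W"
  let ?v = "step_prob (mix_uniform \<eta> P) (\<lambda>x i. mix_uniform \<eta> (W x i))"
  have "(\<Sum>a\<in>UNIV. pmf ?Q a * (log 2 (step_prob P W a) + 2 * log 2 (1 - \<eta>)))
      \<le> (\<Sum>a\<in>UNIV. pmf ?Q a * log 2 (?v a))"
  proof (rule sum_mono)
    fix a :: "'y \<times> 'x \<times> 'y"
    obtain i x j where a: "a = (i, x, j)"
      using prod_cases3 by blast
    show "pmf ?Q a * (log 2 (step_prob P W a) + 2 * log 2 (1 - \<eta>)) \<le> pmf ?Q a * log 2 (?v a)"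
    \<comment> \<open>Comparing logarithms requires both original factors to be positive, which
      holds wherever \<open>?Q\<close> has mass; elsewhere the weight is 0.\<close>
    proof (cases "pmf ?Q a = 0")
      case False
      then have p: "pmf P x > 0" "pmf (W x i) j > 0"
        by (auto simp: a pmf_joint_law pmf_pos)
      have "log 2 (step_prob P W a) + 2 * log 2 (1 - \<eta>) =
          log 2 (((1 - \<eta>) * pmf P x) * ((1 - \<eta>) * pmf (W x i) j))"
        using p \<eta> by (simp add: a step_prob_def log_mult)
      also have "\<dots> \<le> log 2 (?v a)"
        unfolding a step_prob_def prod.case using p \<eta>
        by (intro log_mono mult_mono pmf_mix_uniform_ge mult_pos_pos) auto
      finally show ?thesis
        by (intro mult_left_mono) auto
    qed simp
  qed
  moreover have "(\<Sum>a\<in>UNIV. pmf ?Q a) = 1"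
    by (rule sum_pmf_eq_1) auto
  ultimately show ?thesis
    by (simp add: cond_entropy_joint_step_prob distrib_left sum.distrib flip: sum_distrib_right)
qed

theorem theorem3:
  fixes P :: "'x::finite pmf"
    and W :: "'x \<Rightarrow> 'y::finite \<Rightarrow> 'y pmf"
    and \<pi> :: "'y pmf"
    and \<delta> :: real
  defines "Q \<equiv> joint_law \<pi> P W"
  defines "H \<equiv> cond_entropy_joint Q"
  assumes "\<And>P' :: 'x pmf. unichain_aperiodic (induced_chain P' W)"
    and "equilibrium P W \<pi>"
    and "\<delta> > 0"
  shows "\<exists>\<epsilon>\<^sub>0>0. \<exists>N\<^sub>0 :: nat. \<forall>\<epsilon> n y\<^sub>0. 0 < \<epsilon> \<longrightarrow> \<epsilon> < \<epsilon>\<^sub>0 \<longrightarrow> n > N\<^sub>0 \<longrightarrow>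
           (\<forall>xs ys. (xs, ys) \<in> typical Q y\<^sub>0 \<epsilon> n \<longrightarrow>
              pmf (sequence_law P W n y\<^sub>0) (xs, ys) < 2 powr (- real n * (H - \<delta>)) \<and>
              (pmf (sequence_law P W n y\<^sub>0) (xs, ys) > 0 \<longrightarrow>
               2 powr (- real n * (H + \<delta>)) < pmf (sequence_law P W n y\<^sub>0) (xs, ys))) \<and>
           real (card (typical Q y\<^sub>0 \<epsilon> n)) < 2 powr (real n * (H + \<delta>))"
proof -
  \<comment> \<open>Chosen so that the two mixed factors together cost \<open>\<delta> / 2\<close>
    in the exponent, leaving the other half for the typicality error.\<close>
  define \<eta> where "\<eta> = 1 - 2 powr (- \<delta> / 4)"
  have \<eta>: "0 < \<eta>" "\<eta> < 1"
    using \<open>\<delta> > 0\<close> powr_less_mono[of "- \<delta> / 4" 0 "2::real"] by (simp_all add: \<eta>_def)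
  have log_\<eta>: "2 * log 2 (1 - \<eta>) = - \<delta> / 2"
    by (simp add: \<eta>_def)
  define P' where "P' = mix_uniform \<eta> P"
  define W' where "W' x i = mix_uniform \<eta> (W x i)" for x i
  define L where "L = (\<Sum>a\<in>UNIV. \<bar>log 2 (step_prob P W a)\<bar>)"
  define L' where "L' = (\<Sum>a\<in>UNIV. \<bar>log 2 (step_prob P' W' a)\<bar>)"
  have L: "L \<ge> 0" "L' \<ge> 0"
    by (auto simp: L_def L'_def intro: sum_nonneg)
  \<comment> \<open>One threshold for both claims: it forces
    \<open>\<epsilon> * L < \<delta>\<close> for the AEP and
    \<open>\<epsilon> * L' < \<delta> / 2\<close> for the cardinality. The summand 1 keeps the
    denominator positive.\<close>
  define e where "e = \<delta> / (2 * (L + L' + 1))"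
  have "e > 0"
    using L \<open>\<delta> > 0\<close> by (simp add: e_def)
  have H: "H = - (\<Sum>a\<in>UNIV. pmf Q a * log 2 (step_prob P W a))"
    unfolding H_def Q_def by (rule cond_entropy_joint_step_prob)
  have pos': "step_prob P' W' a > 0" for a
    using \<eta> by (auto simp: step_prob_def P'_def W'_def pmf_mix_uniform_pos split: prod.splits)
  have H': "(\<Sum>a\<in>UNIV. pmf Q a * log 2 (step_prob P' W' a)) \<ge> - H - \<delta> / 2"
    using sum_log_step_prob_mix_uniform_ge[OF \<eta>, of \<pi> P W] log_\<eta>
    by (simp add: H_def Q_def P'_def W'_def[abs_def])
  have main: "(\<forall>xs ys. (xs, ys) \<in> typical Q y0 \<epsilon> n \<longrightarrow>
              pmf (sequence_law P W n y0) (xs, ys) < 2 powr (- real n * (H - \<delta>)) \<and>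
              (pmf (sequence_law P W n y0) (xs, ys) > 0 \<longrightarrow>
               2 powr (- real n * (H + \<delta>)) < pmf (sequence_law P W n y0) (xs, ys))) \<and>
           real (card (typical Q y0 \<epsilon> n)) < 2 powr (real n * (H + \<delta>))"
    if \<epsilon>: "0 < \<epsilon>" "\<epsilon> < e" and n: "n > 0" for \<epsilon> n y0
  proof -
    have "\<epsilon> * (2 * (L + L' + 1)) < \<delta>"
      using \<epsilon> L by (simp add: e_def pos_less_divide_eq)
    moreover have "\<epsilon> * L \<ge> 0" "\<epsilon> * L' \<ge> 0"
      using \<epsilon> L by auto
    ultimately have \<epsilon>L: "\<epsilon> * L < \<delta>" "\<epsilon> * L' < \<delta> / 2"
      using \<epsilon> by (auto simp: distrib_left)
    have "pmf (sequence_law P W n y0) (xs, ys) < 2 powr (- real n * (H - \<delta>)) \<and>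
        2 powr (- real n * (H + \<delta>)) < pmf (sequence_law P W n y0) (xs, ys)"
      if typ_seq: "(xs, ys) \<in> typical Q y0 \<epsilon> n" and pos: "pmf (sequence_law P W n y0) (xs, ys) > 0"
      for xs ys
    proof -
      let ?l = "log 2 (pmf (sequence_law P W n y0) (xs, ys))"
      have "\<bar>?l + n * H\<bar> \<le> n * (\<epsilon> * L)"
        using log_pmf_sequence_law_typical[OF typ_seq n pos] by (simp add: H L_def mult.assoc)
      also have "\<dots> < n * \<delta>"
        using \<epsilon>L n by simp
      finally have "?l < - real n * (H - \<delta>)" "- real n * (H + \<delta>) < ?l"
        by (auto simp: abs_less_iff algebra_simps)
      then show ?thesis
        using pos by (simp add: log_less_iff less_log_iff)
    qed
    \<comment> \<open>A sequence of probability 0 satisfies the upper bound because powers of 2 are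
      positive.\<close>
    moreover have "pmf (sequence_law P W n y0) z < 2 powr (- real n * (H - \<delta>))"
      if "\<not> pmf (sequence_law P W n y0) z > 0" for z
      using that by (simp add: not_less order_le_less_trans)
    moreover have "real (card (typical Q y0 \<epsilon> n)) < 2 powr (n * (H + \<delta>))"
    proof -
      have "real (card (typical Q y0 \<epsilon> n)) \<le>
          2 powr (n * (\<epsilon> * L' - (\<Sum>a\<in>UNIV. pmf Q a * log 2 (step_prob P' W' a))))"
        unfolding L'_def by (rule card_typical_le[OF pos' n])
      \<comment> \<open>Typicality error and mixing loss each contribute at most
        \<open>\<delta> / 2\<close> per step, the former strictly less.\<close>
      also have "\<dots> < 2 powr (n * (H + \<delta>))"
        using \<epsilon>L H' n by (intro powr_less_mono mult_strict_left_mono) auto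
      finally show ?thesis .
    qed
    ultimately show ?thesis
      by blast
  qed
  \<comment> \<open>Both error terms scale linearly with \<open>n\<close>, so every positive length
    works and the length threshold can be 0.\<close>
  show ?thesis
    by (rule exI[of _ e], intro conjI \<open>e > 0\<close>, rule exI[of _ 0]) (intro allI impI main)
qed

end
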